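(* Let $X$ be a Banach space of holomorphic functions on the unit disk $\mathbb{D}$ (continuously embedded in $\mathcal{H}ol(\mathbb{D})$) whose exact predual, with respect to the Cauchy pairing, is $Y$. Let $\lambda_1,\dots,\lambda_n$ be distinct points of $\mathbb{D}$ with multiplicities $n_1,\dots,n_n\ge 1$, let $K_\lambda=\mathrm{span}\{k_{\lambda_i,j}:1\le i\le n,\ 0\le j<n_i\}$, and assume $K_\lambda\subset Y$. Let $w=(w_i^{(j)})_{1\le i\le n,\,0\le j<n_i}$ be complex numbers, and let $\tilde k$ be the linear functional on $K_\lambda$ defined by $$\tilde k(k_{\lambda_i,j})=\overline{w_i^{(j)}},\qquad 1\le i\le n,\ 0\le j\le n_i-1 .$$ Then $$I_X(\lambda,w)=\|\tilde k\|_{(K_\lambda,\|\cdot\|_Y)\to\mathbb{C}}:=\sup_{g\in K_\lambda,\ g\ne 0}\frac{|\tilde k(g)|}{\|g\|_Y},$$ where $$I_X(\lambda,w)=\inf\left\{\|f\|_X:\ f\in X,\ f^{(j)}(\lambda_i)=w_i^{(j)},\ 1\le i\le n,\ 0\le j<n_i\right\}.$$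
   Context: $\mathbb{D}$ is the open unit disk, $\mathcal{H}ol(\mathbb{D})$ the space of holomorphic functions on it, and $\hat f(k)$ the $k$-th Taylor coefficient of $f$ at $0$. The Cauchy pairing is $\langle g,f\rangle=\sum_{k\ge0}\hat g(k)\overline{\hat f(k)}$. $Y$ is the exact predual of $X$ means: $Y$ is a Banach space of holomorphic functions on $\mathbb{D}$ in which the analytic polynomials form a dense subset, and $X=Y'$ isometrically through the pairing: every $f\in X$ defines a bounded linear functional $\tilde f=\langle\cdot,f\rangle$ on $Y$, every bounded linear functional on $Y$ is of this form for a unique $f\in X$, and $$\|f\|_X=\sup_{g\in Y,\,g\neq0}\frac{|\langle g,f\rangle|}{\|g\|_Y},\qquad \|g\|_Y=\sup_{f\in X,\,f\neq0}\frac{|\langle g,f\rangle|}{\|f\|_X}.$$ For $g$ an analytic polynomial or $g\in K_\lambda$, $\langle g,f\rangle$ is the (absolutely convergent) series above; for other $g\in Y$ it is the value of the continuous extension from polynomials. Kernels: for $\mu\in\mathbb{D}$ and $j\ge0$, $k_{\mu}(z)=\frac1{1-\bar\mu z}$ and $k_{\mu,j}=\left(\frac{d}{d\bar\mu}\right)^j k_\mu=\sum_{k\ge j}\frac{k!}{(k-j)!}\bar\mu^{\,k-j}z^k$ (so $k_{0,j}=j!\,z^j$). One has $\overline{\langle k_{\mu,j},f\rangle}=f^{(j)}(\mu)$. *)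

theory Defs
  imports "HOL-Complex_Analysis.Complex_Analysis" "HOL-Library.Function_Algebras"
begin

section \<open>Functions on the unit disk\<close>

text \<open>
  A function on the open unit disk is represented by its extension by \<^term>\<open>0\<close>, so that
  HOL equality of functions is equality on the disk. Addition, subtraction and zero of functions
  are the pointwise ones.
\<close>

abbreviation disc :: "complex set" where
  "disc \<equiv> ball 0 1"

definition on_disc :: "(complex \<Rightarrow> complex) \<Rightarrow> complex \<Rightarrow> complex" where
  "on_disc f z = (if z \<in> disc then f z else 0)"

definition hol_disc :: "(complex \<Rightarrow> complex) set" where
  "hol_disc = {f. f holomorphic_on disc \<and> (\<forall>z. z \<notin> disc \<longrightarrow> f z = 0)}"

definition cfun_scale :: "complex \<Rightarrow> (complex \<Rightarrow> complex) \<Rightarrow> complex \<Rightarrow> complex" where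
  "cfun_scale c f = (\<lambda>z. c * f z)"

interpretation cfun: vector_space cfun_scale
  by unfold_locales (auto simp: cfun_scale_def algebra_simps fun_eq_iff)

definition analytic_polys :: "(complex \<Rightarrow> complex) set" where
  "analytic_polys = range (\<lambda>p. on_disc (poly p))"

definition taylor_coeff :: "(complex \<Rightarrow> complex) \<Rightarrow> nat \<Rightarrow> complex" where
  "taylor_coeff f k = (deriv ^^ k) f 0 / fact k"

section \<open>Banach spaces of holomorphic functions\<close>

definition norm_on :: "(complex \<Rightarrow> complex) set \<Rightarrow> ((complex \<Rightarrow> complex) \<Rightarrow> real) \<Rightarrow> bool" where
  "norm_on V N \<longleftrightarrow>
     (\<forall>f\<in>V. 0 \<le> N f) \<and> (\<forall>f\<in>V. N f = 0 \<longleftrightarrow> f = 0) \<and>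
     (\<forall>c. \<forall>f\<in>V. N (cfun_scale c f) = cmod c * N f) \<and>
     (\<forall>f\<in>V. \<forall>g\<in>V. N (f + g) \<le> N f + N g)"

text \<open>
  \<^term>\<open>Metric_space V\<close> asks for symmetry and nonnegativity of the distance also outside
  \<^term>\<open>V\<close>, where \<^term>\<open>N\<close> is unconstrained; hence the case distinction.
\<close>

definition norm_dist ::
  "(complex \<Rightarrow> complex) set \<Rightarrow> ((complex \<Rightarrow> complex) \<Rightarrow> real)
     \<Rightarrow> (complex \<Rightarrow> complex) \<Rightarrow> (complex \<Rightarrow> complex) \<Rightarrow> real" where
  "norm_dist V N f g = (if f \<in> V \<and> g \<in> V then N (f - g) else 0)"

definition banach_hol_space ::
  "(complex \<Rightarrow> complex) set \<Rightarrow> ((complex \<Rightarrow> complex) \<Rightarrow> real) \<Rightarrow> bool" where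
  "banach_hol_space V N \<longleftrightarrow>
     V \<subseteq> hol_disc \<and> cfun.subspace V \<and> norm_on V N \<and> Metric_space.mcomplete V (norm_dist V N)"

lemma Metric_space_norm_dist:
  assumes "cfun.subspace V" "norm_on V N"
  shows "Metric_space V (norm_dist V N)"
proof
  have diff: "f - g \<in> V" if "f \<in> V" "g \<in> V" for f g
    using assms(1) that by (rule cfun.subspace_diff)
  have sym: "N (f - g) = N (g - f)" if "f \<in> V" "g \<in> V" for f g
  proof -
    have "f - g = cfun_scale (-1) (g - f)"
      by (auto simp: cfun_scale_def)
    moreover have "N (cfun_scale (-1) (g - f)) = N (g - f)"
      using assms(2) diff[OF that(2,1)] unfolding norm_on_def by (metis mult_1 norm_minus_cancel norm_one)
    ultimately show ?thesis
      by simp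
  qed
  show "0 \<le> norm_dist V N x y" for x y
    using assms(2) diff by (auto simp: norm_dist_def norm_on_def)
  show "norm_dist V N x y = norm_dist V N y x" for x y
    using sym by (auto simp: norm_dist_def)
  show "norm_dist V N x y = 0 \<longleftrightarrow> x = y" if "x \<in> V" "y \<in> V" for x y
  proof -
    have "x - y = 0 \<longleftrightarrow> x = y"
      by (auto simp: fun_eq_iff)
    then show ?thesis
      using assms(2) diff[OF that] that by (simp add: norm_dist_def norm_on_def)
  qed
  show "norm_dist V N x z \<le> norm_dist V N x y + norm_dist V N y z"
    if "x \<in> V" "y \<in> V" "z \<in> V" for x y z
  proof -
    have "x - z = (x - y) + (y - z)"
      by (auto simp: fun_eq_iff)
    moreover have "N ((x - y) + (y - z)) \<le> N (x - y) + N (y - z)"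
      using assms(2) diff[OF that(1,2)] diff[OF that(2,3)] unfolding norm_on_def by blast
    ultimately show ?thesis
      using that by (simp add: norm_dist_def)
  qed
qed

text \<open>
  Continuity of the inclusion into the holomorphic functions, whose topology is given by the
  seminorms \<^term>\<open>\<lambda>f. SUP z\<in>C. cmod (f z)\<close> for compact subsets \<^term>\<open>C\<close> of the disk.
\<close>

definition continuously_embedded ::
  "(complex \<Rightarrow> complex) set \<Rightarrow> ((complex \<Rightarrow> complex) \<Rightarrow> real) \<Rightarrow> bool" where
  "continuously_embedded V N \<longleftrightarrow>
     (\<forall>C. compact C \<and> C \<subseteq> disc \<longrightarrow> (\<exists>B. \<forall>f\<in>V. \<forall>z\<in>C. cmod (f z) \<le> B * N f))"

section \<open>Linear functionals\<close>

definition linear_functional_on ::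
  "(complex \<Rightarrow> complex) set \<Rightarrow> ((complex \<Rightarrow> complex) \<Rightarrow> complex) \<Rightarrow> bool" where
  "linear_functional_on V F \<longleftrightarrow>
     (\<forall>f\<in>V. \<forall>g\<in>V. F (f + g) = F f + F g) \<and> (\<forall>c. \<forall>f\<in>V. F (cfun_scale c f) = c * F f)"

definition bounded_functional_on ::
  "(complex \<Rightarrow> complex) set \<Rightarrow> ((complex \<Rightarrow> complex) \<Rightarrow> real)
     \<Rightarrow> ((complex \<Rightarrow> complex) \<Rightarrow> complex) \<Rightarrow> bool" where
  "bounded_functional_on V N F \<longleftrightarrow>
     linear_functional_on V F \<and> (\<exists>B. \<forall>f\<in>V. cmod (F f) \<le> B * N f)"

definition functional_norm ::
  "(complex \<Rightarrow> complex) set \<Rightarrow> ((complex \<Rightarrow> complex) \<Rightarrow> real)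
     \<Rightarrow> ((complex \<Rightarrow> complex) \<Rightarrow> complex) \<Rightarrow> ereal" where
  "functional_norm V N F = (SUP g\<in>V - {0}. ereal (cmod (F g) / N g))"

section \<open>Kernels\<close>

text \<open>
  The derivative with respect to the conjugate of \<^term>\<open>\<mu>\<close> is the complex derivative in
  a variable \<^term>\<open>\<nu>\<close>, evaluated at \<^term>\<open>cnj \<mu>\<close>.
\<close>

definition disc_kernel :: "complex \<Rightarrow> nat \<Rightarrow> complex \<Rightarrow> complex" where
  "disc_kernel \<mu> j = on_disc (\<lambda>z. (deriv ^^ j) (\<lambda>\<nu>. 1 / (1 - \<nu> * z)) (cnj \<mu>))"

definition kernel_span :: "nat \<Rightarrow> (nat \<Rightarrow> complex) \<Rightarrow> (nat \<Rightarrow> nat) \<Rightarrow> (complex \<Rightarrow> complex) set" where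
  "kernel_span n lam m = cfun.span {disc_kernel (lam i) j |i j. i \<in> {1..n} \<and> j < m i}"

section \<open>The Cauchy pairing and exact preduals\<close>

definition cauchy_series :: "(complex \<Rightarrow> complex) \<Rightarrow> (complex \<Rightarrow> complex) \<Rightarrow> complex" where
  "cauchy_series g f = (\<Sum>k. taylor_coeff g k * cnj (taylor_coeff f k))"

text \<open>
  The pairing is the series when the first argument is a polynomial or lies in \<^term>\<open>K\<close>
  (a span of kernels). For the other elements of \<^term>\<open>Y\<close> it is the limit of the
  pairing along polynomials converging to them in \<^term>\<open>Y\<close>.
\<close>

definition cauchy_pairing ::
  "(complex \<Rightarrow> complex) set \<Rightarrow> (complex \<Rightarrow> complex) set \<Rightarrow> ((complex \<Rightarrow> complex) \<Rightarrow> real)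
     \<Rightarrow> (complex \<Rightarrow> complex) \<Rightarrow> (complex \<Rightarrow> complex) \<Rightarrow> complex" where
  "cauchy_pairing K Y NY g f =
     (if g \<in> analytic_polys \<union> K then cauchy_series g f
      else Lim (atin_within (Metric_space.mtopology Y (norm_dist Y NY)) g analytic_polys)
             (\<lambda>p. cauchy_series p f))"

definition exact_predual ::
  "(complex \<Rightarrow> complex) set
     \<Rightarrow> (complex \<Rightarrow> complex) set \<Rightarrow> ((complex \<Rightarrow> complex) \<Rightarrow> real)
     \<Rightarrow> (complex \<Rightarrow> complex) set \<Rightarrow> ((complex \<Rightarrow> complex) \<Rightarrow> real) \<Rightarrow> bool" where
  "exact_predual K Y NY X NX \<longleftrightarrow>
     banach_hol_space Y NY \<and>
     analytic_polys \<subseteq> Y \<and>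
     Metric_space.mtopology Y (norm_dist Y NY) closure_of analytic_polys = Y \<and>
     (\<forall>f\<in>X. bounded_functional_on Y NY (\<lambda>g. cauchy_pairing K Y NY g f)) \<and>
     (\<forall>F. bounded_functional_on Y NY F \<longrightarrow>
        (\<exists>!f. f \<in> X \<and> (\<forall>g\<in>Y. F g = cauchy_pairing K Y NY g f))) \<and>
     (\<forall>f\<in>X. ereal (NX f) = functional_norm Y NY (\<lambda>g. cauchy_pairing K Y NY g f)) \<and>
     (\<forall>g\<in>Y. ereal (NY g) = functional_norm X NX (\<lambda>f. cauchy_pairing K Y NY g f))"

section \<open>The interpolation quantity\<close>

text \<open>
  The infimum is taken in the extended reals, so that it is \<^term>\<open>\<infinity>\<close> if there is no
  interpolant.
\<close>

definition interp_norm ::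
  "(complex \<Rightarrow> complex) set \<Rightarrow> ((complex \<Rightarrow> complex) \<Rightarrow> real)
     \<Rightarrow> nat \<Rightarrow> (nat \<Rightarrow> complex) \<Rightarrow> (nat \<Rightarrow> nat) \<Rightarrow> (nat \<Rightarrow> nat \<Rightarrow> complex) \<Rightarrow> ereal" where
  "interp_norm X NX n lam m w =
     (INF f\<in>{f \<in> X. \<forall>i\<in>{1..n}. \<forall>j<m i. (deriv ^^ j) f (lam i) = w i j}. ereal (NX f))"

end

theory Submission
  imports Defs
begin

text \<open>
  An interpolant \<open>f\<close> induces through the pairing a functional on \<open>Y\<close> which restricts to
  \<open>ktilde\<close> on the span of the kernels, because the kernels represent the values and derivatives;
  conversely, by exact duality, every extension of \<open>ktilde\<close> to \<open>Y\<close> comes from an interpolant.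
  The Hahn-Banach theorem provides an extension of the same norm.
\<close>

section \<open>The Hahn-Banach theorem\<close>

text \<open>
  Zorn's lemma is applied to linear relations \<open>G\<close> with \<open>a \<le> p x\<close> for \<open>(x, a) \<in> G\<close>;
  since \<open>p 0 = 0\<close>, such a relation is automatically the graph of a function.
\<close>

lemma hahn_banach_real:
  fixes s :: "real \<Rightarrow> 'a::ab_group_add \<Rightarrow> 'a" and f p :: "'a \<Rightarrow> real"
  assumes "vector_space s"
    and Y: "module.subspace s Y" and W: "module.subspace s W" "W \<subseteq> Y"
    and f_add: "\<And>x y. x \<in> W \<Longrightarrow> y \<in> W \<Longrightarrow> f (x + y) = f x + f y"
    and f_scale: "\<And>c x. x \<in> W \<Longrightarrow> f (s c x) = c * f x"
    and p_add: "\<And>x y. x \<in> Y \<Longrightarrow> y \<in> Y \<Longrightarrow> p (x + y) \<le> p x + p y"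
    and p_scale: "\<And>c x. 0 \<le> c \<Longrightarrow> x \<in> Y \<Longrightarrow> p (s c x) = c * p x"
    and f_le: "\<And>x. x \<in> W \<Longrightarrow> f x \<le> p x"
  obtains F where "\<And>x y. x \<in> Y \<Longrightarrow> y \<in> Y \<Longrightarrow> F (x + y) = F x + F y"
    and "\<And>c x. x \<in> Y \<Longrightarrow> F (s c x) = c * F x"
    and "\<And>x. x \<in> W \<Longrightarrow> F x = f x"
    and "\<And>x. x \<in> Y \<Longrightarrow> F x \<le> p x"
proof -
  interpret vector_space s by fact
  note Y_simps = subspace_0[OF Y] subspace_add[OF Y] subspace_diff[OF Y] subspace_scale[OF Y]
  define A where "A = {G. (\<lambda>x. (x, f x)) ` W \<subseteq> G
    \<and> (\<forall>x a. (x, a) \<in> G \<longrightarrow> x \<in> Y \<and> a \<le> p x)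
    \<and> (\<forall>x a y b. (x, a) \<in> G \<and> (y, b) \<in> G \<longrightarrow> (x + y, a + b) \<in> G)
    \<and> (\<forall>c x a. (x, a) \<in> G \<longrightarrow> (s c x, c * a) \<in> G)}"
  have "(\<lambda>x. (x, f x)) ` W \<in> A"
    using W(2) f_le by (auto simp: A_def f_add f_scale subspace_add[OF W(1)] subspace_scale[OF W(1)])
  moreover have "\<Union>C \<in> A" if "C \<noteq> {}" and chain: "subset.chain A C" for C
  proof -
    have C: "G \<in> A" if "G \<in> C" for G
      using chain that by (auto simp: subset.chain_def)
    \<comment> \<open>Two pairs of the union may come from different members of the chain. The
      larger of these contains both, so its closure under addition applies.\<close>
    have lin: "\<exists>G\<in>C. u \<in> G \<and> v \<in> G" if uv: "u \<in> \<Union>C" "v \<in> \<Union>C" for u v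
    proof -
      obtain G H where "G \<in> C" "H \<in> C" "u \<in> G" "v \<in> H"
        using uv by blast
      moreover from this have "G \<subseteq> H \<or> H \<subseteq> G"
        using chain by (auto simp: subset_chain_def)
      ultimately show ?thesis
        by blast
    qed
    have "(x + y, a + b) \<in> \<Union>C" if u: "(x, a) \<in> \<Union>C" and v: "(y, b) \<in> \<Union>C" for x a y b
    proof -
      obtain G where "G \<in> C" "(x, a) \<in> G" "(y, b) \<in> G"
        using lin[OF u v] by blast
      then have "(x + y, a + b) \<in> G"
        using C[of G] unfolding A_def by blast
      then show ?thesis
        using \<open>G \<in> C\<close> by blast
    qed
    moreover have "(s c x, c * a) \<in> \<Union>C" if "(x, a) \<in> \<Union>C" for c x a
      using that C unfolding A_def by blast
    moreover have "(\<lambda>x. (x, f x)) ` W \<subseteq> \<Union>C"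
      using C \<open>C \<noteq> {}\<close> unfolding A_def by blast
    moreover have "x \<in> Y \<and> a \<le> p x" if "(x, a) \<in> \<Union>C" for x a
      using that C unfolding A_def by blast
    ultimately show ?thesis
      unfolding A_def by blast
  qed
  ultimately obtain M where M: "M \<in> A" and max: "\<And>G. G \<in> A \<Longrightarrow> M \<subseteq> G \<Longrightarrow> G = M"
    using subset_Zorn_nonempty[of A] by blast
  have M_W: "(x, f x) \<in> M" if "x \<in> W" for x
    using M that unfolding A_def by blast
  have M_Y: "x \<in> Y" and M_le: "a \<le> p x" if "(x, a) \<in> M" for x a
    using M that unfolding A_def by blast+
  have M_add: "(x + y, a + b) \<in> M" if "(x, a) \<in> M" "(y, b) \<in> M" for x a y b
    using M that unfolding A_def by blast
  have M_scale: "(s c x, c * a) \<in> M" if "(x, a) \<in> M" for c x a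
    using M that unfolding A_def by blast
  have M_0: "(0, 0) \<in> M"
    using M_scale[OF M_W[OF subspace_0[OF W(1)]], of 0] by simp
  have p_0: "p 0 = 0"
    using p_scale[of 0 0] Y_simps(1) by simp
  have M_diff: "(x - y, a - b) \<in> M" if "(x, a) \<in> M" "(y, b) \<in> M" for x a y b
    using M_add[OF that(1) M_scale[OF that(2), of "-1"]] by simp
  \<comment> \<open>The difference of two pairs over \<open>x\<close> is \<open>(0, a - b)\<close>,
    which gives \<open>a - b\<close> \<le> \<open>p 0\<close>, that is 0. Exchanging the pairs gives
    the reverse inequality.\<close>
  have M_unique: "a = b" if "(x, a) \<in> M" "(x, b) \<in> M" for x a b
    using M_le[OF M_diff[OF that]] M_le[OF M_diff[OF that(2,1)]] p_0 by simp
  have dom: "\<exists>a. (z, a) \<in> M" if z: "z \<in> Y" for z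
  proof -
    \<comment> \<open>\<open>c\<close> is to be the value at \<open>z\<close>. Domination at
      \<open>x - z\<close> and at \<open>y + z\<close> demands \<open>a - p (x - z)\<close> \<le>
      \<open>c\<close> \<le> \<open>p (y + z) - b\<close>. By \<open>sep\<close> every lower bound
      lies below every upper bound, so the supremum of the lower bounds satisfies both.\<close>
    define c where "c = (SUP (x, a)\<in>M. a - p (x - z))"
    have sep: "a - p (x - z) \<le> p (y + z) - b" if xa: "(x, a) \<in> M" and yb: "(y, b) \<in> M" for x a y b
    proof -
      have "a + b \<le> p ((x - z) + (y + z))"
        using M_le[OF M_add[OF xa yb]] by simp
      also have "\<dots> \<le> p (x - z) + p (y + z)"
        using M_Y[OF xa] M_Y[OF yb] z by (intro p_add Y_simps)
      finally show ?thesis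
        by simp
    qed
    have c_ge: "a - p (x - z) \<le> c" if "(x, a) \<in> M" for x a
    proof -
      have "bdd_above ((\<lambda>(x, a). a - p (x - z)) ` M)"
        using sep[OF _ M_0] by (intro bdd_aboveI[of _ "p (0 + z) - 0"]) auto
      from cSUP_upper[OF that this] show ?thesis
        unfolding c_def by simp
    qed
    have c_le: "c \<le> p (y + z) - b" if "(y, b) \<in> M" for y b
      unfolding c_def using M_0 sep[OF _ that] by (intro cSUP_least) auto
    \<comment> \<open>Homogeneity reduces this to the coefficients 1 and -1. For
      \<open>t > 0\<close> the upper bound on \<open>c\<close> is taken at
      \<open>s (1 / t) x\<close> and multiplied by \<open>t\<close>; for \<open>t < 0\<close> the
      lower bound is taken at \<open>s (1 / u) x\<close> and multiplied by
      \<open>u = - t\<close>.\<close>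
    have bound: "a + t * c \<le> p (x + s t z)" if xa: "(x, a) \<in> M" for x a t
    proof -
      note x = M_Y[OF xa]
      consider "t = 0" | "t > 0" | "t < 0"
        by linarith
      then show ?thesis
      proof cases
        case 1
        then show ?thesis
          using M_le[OF xa] by simp
      next
        case 2
        have "t * c \<le> t * (p (s (1 / t) x + z) - 1 / t * a)"
          using 2 by (intro mult_left_mono c_le M_scale xa) auto
        also have "\<dots> = p (s t (s (1 / t) x + z)) - a"
          using 2 x z by (subst p_scale) (auto simp: algebra_simps intro!: Y_simps)
        also have "s t (s (1 / t) x + z) = x + s t z"
          using 2 by (simp add: scale_right_distrib)
        finally show ?thesis
          by simp
      next
        case 3
        define u where "u = - t"
        have u: "u > 0" "t = - u"
          using 3 by (auto simp: u_def)
        have "a - p (s u (s (1 / u) x - z)) = u * (1 / u * a - p (s (1 / u) x - z))"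
          using u x z by (subst p_scale) (auto simp: algebra_simps intro!: Y_simps)
        also have "\<dots> \<le> u * c"
          using u by (intro mult_left_mono c_ge M_scale xa) auto
        finally have "a - p (s u (s (1 / u) x - z)) \<le> u * c" .
        moreover have "s u (s (1 / u) x - z) = x + s t z"
          using u by (simp add: scale_right_diff_distrib)
        ultimately show ?thesis
          using u by simp
      qed
    qed
    \<comment> \<open>\<open>G\<close> adjoins the line through \<open>z\<close> to
      \<open>M\<close>. Maximality forces \<open>G = M\<close>, so the pair \<open>(z, c)\<close> of
      \<open>G\<close> already lies in \<open>M\<close>.\<close>
    define G where "G = {(x + s t z, a + t * c) |x a t. (x, a) \<in> M}"
    have G_I: "(y, b) \<in> G" if "(x, a) \<in> M" "y = x + s t z" "b = a + t * c" for x a t y b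
      using that unfolding G_def by blast
    have "M \<subseteq> G"
    proof
      fix v assume "v \<in> M"
      then show "v \<in> G"
        by (cases v) (auto intro: G_I[where t = 0])
    qed
    moreover have "G \<in> A"
    proof -
      have "(x + y, a + b) \<in> G" if xy: "(x, a) \<in> G" "(y, b) \<in> G" for x a y b
      proof -
        obtain x' a' t y' b' r where "(x', a') \<in> M" "(y', b') \<in> M"
          "x = x' + s t z" "a = a' + t * c" "y = y' + s r z" "b = b' + r * c"
          using xy unfolding G_def by blast
        then show ?thesis
          by (intro G_I[OF M_add[of x' a' y' b'], where t = "t + r"])
            (auto simp: algebra_simps)
      qed
      moreover have "(s d x, d * a) \<in> G" if xa: "(x, a) \<in> G" for d x a
      proof -
        obtain x' a' t where "(x', a') \<in> M" "x = x' + s t z" "a = a' + t * c"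
          using xa unfolding G_def by blast
        then show ?thesis
          by (intro G_I[OF M_scale[of x' a' d], where t = "d * t"]) (auto simp: algebra_simps)
      qed
      moreover have "x \<in> Y \<and> a \<le> p x" if "(x, a) \<in> G" for x a
        using that bound M_Y z unfolding G_def by (auto intro!: Y_simps)
      moreover have "(\<lambda>x. (x, f x)) ` W \<subseteq> G"
        using M_W \<open>M \<subseteq> G\<close> by blast
      ultimately show ?thesis
        unfolding A_def by blast
    qed
    ultimately have "G = M"
      by (rule max[rotated])
    moreover have "(z, c) \<in> G"
      using M_0 by (rule G_I[where t = 1]) auto
    ultimately show ?thesis
      by blast
  qed
  define F where "F x = (THE a. (x, a) \<in> M)" for x
  have F_eq: "F x = a" if "(x, a) \<in> M" for x a
    unfolding F_def using that M_unique by blast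
  have F: "(x, F x) \<in> M" if "x \<in> Y" for x
    using dom[OF that] F_eq by auto
  show thesis
  proof
    show "F (x + y) = F x + F y" if "x \<in> Y" "y \<in> Y" for x y
      by (intro F_eq M_add F that)
    show "F (s c x) = c * F x" if "x \<in> Y" for c x
      by (intro F_eq M_scale F that)
    show "F x = f x" if "x \<in> W" for x
      by (intro F_eq M_W that)
    show "F x \<le> p x" if "x \<in> Y" for x
      by (intro M_le F that)
  qed
qed

text \<open>With scalars restricted to the reals, the real theorem extends the real part of
  \<open>f\<close> to some \<open>U\<close>. A complex linear functional is determined by its real
  part, which dictates the extension \<open>F\<close>, and a rotation turns the bound on
  \<open>U\<close> into one on the modulus of \<open>F\<close>.\<close>

lemma hahn_banach_complex:
  fixes s :: "complex \<Rightarrow> 'a::ab_group_add \<Rightarrow> 'a" and f :: "'a \<Rightarrow> complex" and p :: "'a \<Rightarrow> real"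
  assumes "vector_space s"
    and Y: "module.subspace s Y" and W: "module.subspace s W" "W \<subseteq> Y"
    and f_add: "\<And>x y. x \<in> W \<Longrightarrow> y \<in> W \<Longrightarrow> f (x + y) = f x + f y"
    and f_scale: "\<And>c x. x \<in> W \<Longrightarrow> f (s c x) = c * f x"
    and p_add: "\<And>x y. x \<in> Y \<Longrightarrow> y \<in> Y \<Longrightarrow> p (x + y) \<le> p x + p y"
    and p_scale: "\<And>c x. x \<in> Y \<Longrightarrow> p (s c x) = cmod c * p x"
    and f_le: "\<And>x. x \<in> W \<Longrightarrow> cmod (f x) \<le> p x"
  obtains F where "\<And>x y. x \<in> Y \<Longrightarrow> y \<in> Y \<Longrightarrow> F (x + y) = F x + F y"
    and "\<And>c x. x \<in> Y \<Longrightarrow> F (s c x) = c * F x"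
    and "\<And>x. x \<in> W \<Longrightarrow> F x = f x"
    and "\<And>x. x \<in> Y \<Longrightarrow> cmod (F x) \<le> p x"
proof -
  interpret vector_space s by fact
  note Y_simps = subspace_0[OF Y] subspace_add[OF Y] subspace_scale[OF Y]
  note W_simps = subspace_0[OF W(1)] subspace_add[OF W(1)] subspace_scale[OF W(1)]
  define r where "r c = s (complex_of_real c)" for c
  interpret real: vector_space r
    by unfold_locales (auto simp: r_def scale_right_distrib scale_left_distrib)
  obtain U where U_add: "\<And>x y. x \<in> Y \<Longrightarrow> y \<in> Y \<Longrightarrow> U (x + y) = U x + U y"
    and U_real: "\<And>c x. x \<in> Y \<Longrightarrow> U (r c x) = c * U x"
    and U_W: "\<And>x. x \<in> W \<Longrightarrow> U x = Re (f x)"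
    and U_le: "\<And>x. x \<in> Y \<Longrightarrow> U x \<le> p x"
  proof (rule hahn_banach_real)
    show "vector_space r" ..
    show "real.subspace Y" "real.subspace W"
      by (auto simp: real.subspace_def r_def Y_simps W_simps)
    show "Re (f x) \<le> p x" if "x \<in> W" for x
      using f_le[OF that] complex_Re_le_cmod[of "f x"] by linarith
  qed (use W f_add f_scale p_add p_scale in \<open>auto simp: r_def\<close>)
  \<comment> \<open>Complex linearity forces Im F(x) = - Re F(ix).\<close>
  define F where "F x = Complex (U x) (- U (s \<i> x))" for x
  have U_scale: "U (s c x) = Re c * U x + Im c * U (s \<i> x)" if "x \<in> Y" for c x
  proof -
    have "s c x = r (Re c) x + r (Im c) (s \<i> x)"
      by (simp add: r_def flip: scale_left_distrib) (simp add: complex_eq_iff)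
    also have "U \<dots> = U (r (Re c) x) + U (r (Im c) (s \<i> x))"
      using that by (intro U_add) (auto simp: r_def intro: Y_simps)
    also have "\<dots> = Re c * U x + Im c * U (s \<i> x)"
      using that by (simp add: U_real Y_simps)
    finally show ?thesis .
  qed
  \<comment> \<open>The imaginary part of \<open>F (s c x)\<close> involves \<open>U\<close> at
    \<open>s (\<i> * c) x\<close>, hence the second use of \<open>U_scale\<close>.\<close>
  have F_scale: "F (s c x) = c * F x" if "x \<in> Y" for c x
    using U_scale[OF that, of c] U_scale[OF that, of "\<i> * c"] by (simp add: F_def complex_eq_iff)
  show thesis
  proof
    show "F (x + y) = F x + F y" if "x \<in> Y" "y \<in> Y" for x y
      using that by (simp add: F_def complex_eq_iff U_add scale_right_distrib Y_simps)
    show "F (s c x) = c * F x" if "x \<in> Y" for c x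
      by (rule F_scale[OF that])
    show "F x = f x" if "x \<in> W" for x
      using that by (simp add: F_def complex_eq_iff U_W f_scale W_simps)
    show "cmod (F x) \<le> p x" if x: "x \<in> Y" for x
    proof (cases "F x = 0")
      case True
      \<comment> \<open>Subadditivity applied to \<open>x\<close> and its negative gives 0 =
        \<open>p 0\<close> \<le> \<open>2 * p x\<close>.\<close>
      have "0 \<le> p x"
        using p_add[OF x Y_simps(3)[OF x, of "-1"]] p_scale[OF x, of 0] p_scale[OF x, of "-1"] by simp
      then show ?thesis
        using True by simp
    next
      case False
      \<comment> \<open>The unimodular factor that rotates \<open>F x\<close> onto the nonnegative
        real axis. There the modulus equals the real part \<open>U (s c x)\<close>, which
        \<open>p\<close> dominates, and \<open>p\<close> is unchanged by the rotation.\<close>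
      define c where "c = cnj (sgn (F x))"
      have "cmod c = 1"
        using False by (simp add: c_def norm_sgn)
      have "c * F x = cmod (F x)"
        using False by (simp add: c_def sgn_eq mult.commute complex_norm_square[symmetric] field_simps
            power2_eq_square)
      then have "cmod (F x) = Re (F (s c x))"
        using F_scale[OF x] by simp
      also have "\<dots> = U (s c x)"
        by (simp add: F_def)
      also have "\<dots> \<le> p (s c x)"
        using x by (intro U_le Y_simps)
      also have "\<dots> = p x"
        using x \<open>cmod c = 1\<close> by (simp add: p_scale)
      finally show ?thesis .
    qed
  qed
qed

section \<open>Kernels represent derivatives\<close>

text \<open>Uniqueness of power series coefficients. It is applied to the geometric series in \<nu>
  and to the kernel as a series in z.\<close>

lemma higher_deriv_0_of_sums:
  fixes g :: "complex \<Rightarrow> complex"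
  assumes "0 < r" "\<And>z. z \<in> ball 0 r \<Longrightarrow> (\<lambda>k. a k * z ^ k) sums g z"
  shows "(deriv ^^ k) g 0 = a k * fact k"
proof -
  have "eventually (\<lambda>z. z \<in> ball 0 r) (nhds (0::complex))"
    using assms(1) by (intro eventually_nhds_in_open) auto
  then have "g has_fps_expansion Abs_fps a"
    by (intro has_fps_expansionI) (auto elim!: eventually_mono intro: assms(2))
  from fps_nth_fps_expansion[OF this, of k] show ?thesis
    by simp
qed

lemma higher_deriv_sums:
  assumes "f holomorphic_on ball 0 r" "\<mu> \<in> ball 0 r"
  shows "(\<lambda>k. (deriv ^^ (k + j)) f 0 / fact k * \<mu> ^ k) sums (deriv ^^ j) f \<mu>"
proof -
  have "(deriv ^^ j) f holomorphic_on ball 0 r"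
    using assms(1) by (intro holomorphic_higher_deriv) auto
  from holomorphic_power_series[OF this assms(2)] show ?thesis
    by (simp add: funpow_add)
qed

text \<open>For fixed \<open>z\<close> the kernel is the value at \<open>cnj \<mu>\<close> of the
  \<open>j\<close>-th derivative of the geometric series in \<nu>. Expanding this derivative about 0
  yields terms that are also monomials in \<open>z\<close>.\<close>

lemma disc_kernel_sums:
  assumes "\<mu> \<in> disc" "z \<in> disc"
  shows "(\<lambda>k. fact (k + j) / fact k * cnj \<mu> ^ k * z ^ (k + j)) sums disc_kernel \<mu> j z"
proof -
  define h where "h = (\<lambda>\<nu>. 1 / (1 - \<nu> * z))"
  have small: "cmod (\<nu> * z) < 1" if "\<nu> \<in> disc" for \<nu>
    using assms(2) that mult_strict_mono'[of "cmod \<nu>" 1 "cmod z" 1] by (simp add: norm_mult)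
  have "(\<lambda>k. z ^ k * \<nu> ^ k) sums h \<nu>" if "\<nu> \<in> disc" for \<nu>
    using geometric_sums[OF small[OF that]] by (simp add: h_def power_mult_distrib mult.commute)
  then have h0: "(deriv ^^ k) h 0 = z ^ k * fact k" for k
    by (rule higher_deriv_0_of_sums[of 1, rotated]) auto
  have "h holomorphic_on disc"
    unfolding h_def using small by (intro holomorphic_intros) fastforce
  then have "(\<lambda>k. (deriv ^^ (k + j)) h 0 / fact k * cnj \<mu> ^ k) sums (deriv ^^ j) h (cnj \<mu>)"
    using assms(1) by (intro higher_deriv_sums) auto
  then have "(\<lambda>k. z ^ (k + j) * fact (k + j) / fact k * cnj \<mu> ^ k) sums (deriv ^^ j) h (cnj \<mu>)"
    by (simp only: h0)
  then show ?thesis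
    using assms(2) by (simp add: disc_kernel_def on_disc_def h_def mult_ac)
qed

lemma taylor_coeff_disc_kernel:
  assumes "\<mu> \<in> disc"
  shows "taylor_coeff (disc_kernel \<mu> j) k = (if k < j then 0 else fact k / fact (k - j) * cnj \<mu> ^ (k - j))"
    (is "_ = ?a k")
proof -
  have "(\<lambda>k. ?a k * z ^ k) sums disc_kernel \<mu> j z" if "z \<in> disc" for z
  proof -
    \<comment> \<open>The first \<open>j\<close> coefficients vanish, so the series may start at
      index \<open>j\<close> without changing its sum.\<close>
    have "(\<lambda>k. ?a (k + j) * z ^ (k + j)) sums disc_kernel \<mu> j z"
      using disc_kernel_sums[OF assms that, of j] by simp
    then show ?thesis
      by (subst (asm) sums_iff_shift) simp
  qed
  then have "(deriv ^^ k) (disc_kernel \<mu> j) 0 = ?a k * fact k"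
    by (rule higher_deriv_0_of_sums[of 1, rotated]) auto
  then show ?thesis
    by (simp add: taylor_coeff_def)
qed

text \<open>In the term of index \<open>k + j\<close> the factor \<open>fact (k + j)\<close> of the
  kernel cancels the one in the Taylor coefficient of \<open>f\<close>. What remains is the
  conjugate of the Taylor series about 0 of the \<open>j\<close>-th derivative of \<open>f\<close>,
  evaluated at \<mu>.\<close>

lemma cauchy_series_disc_kernel:
  assumes "f holomorphic_on disc" "\<mu> \<in> disc"
  shows "cauchy_series (disc_kernel \<mu> j) f = cnj ((deriv ^^ j) f \<mu>)"
proof -
  let ?t = "\<lambda>k. taylor_coeff (disc_kernel \<mu> j) k * cnj (taylor_coeff f k)"
  have "(\<lambda>k. cnj ((deriv ^^ (k + j)) f 0 / fact k * \<mu> ^ k)) sums cnj ((deriv ^^ j) f \<mu>)"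
    using higher_deriv_sums[OF assms] by (simp only: sums_cnj)
  moreover have "cnj ((deriv ^^ (k + j)) f 0 / fact k * \<mu> ^ k) = ?t (k + j)" for k
    by (simp add: taylor_coeff_disc_kernel[OF assms(2)] taylor_coeff_def[of f])
  ultimately have "(\<lambda>k. ?t (k + j)) sums cnj ((deriv ^^ j) f \<mu>)"
    by simp
  then have "?t sums cnj ((deriv ^^ j) f \<mu>)"
    by (subst (asm) sums_iff_shift) (simp add: taylor_coeff_disc_kernel[OF assms(2)])
  then show ?thesis
    by (simp add: cauchy_series_def sums_iff)
qed

text \<open>The value at the origin is 1. This keeps the supremum defining the norm on the kernel
  span from ranging over the empty set.\<close>

lemma disc_kernel_0_nonzero: "disc_kernel \<mu> 0 \<noteq> 0"
proof
  assume "disc_kernel \<mu> 0 = 0"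
  then have "disc_kernel \<mu> 0 0 = 0"
    by simp
  then show False
    by (simp add: disc_kernel_def on_disc_def)
qed

section \<open>Interpolation\<close>

text \<open>The supremum omits \<open>g = 0\<close>, where both sides of the pointwise bound vanish;
  elsewhere \<open>N g\<close> is positive and can be multiplied across.\<close>

lemma functional_norm_le_iff:
  assumes "norm_on V N" "linear_functional_on V F" "0 \<in> V"
  shows "functional_norm V N F \<le> ereal r \<longleftrightarrow> (\<forall>g\<in>V. cmod (F g) \<le> r * N g)"
proof -
  have "F (cfun_scale 0 0) = 0 * F 0"
    using assms(2,3) unfolding linear_functional_on_def by blast
  then have "F 0 = 0" "N 0 = 0"
    using assms(1,3) by (auto simp: norm_on_def)
  moreover have "N g > 0" if "g \<in> V" "g \<noteq> 0" for g
    using assms(1) that unfolding norm_on_def by (metis less_eq_real_def)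
  ultimately show ?thesis
    unfolding functional_norm_def by (force simp: SUP_le_iff divide_le_eq)
qed

text \<open>The points of the span where \<open>F\<close> and \<open>G\<close> agree form a subspace
  containing \<open>S\<close>.\<close>

lemma linear_functionals_eq_on_span:
  assumes "linear_functional_on (cfun.span S) F" "linear_functional_on (cfun.span S) G"
    and "\<And>g. g \<in> S \<Longrightarrow> F g = G g" "g \<in> cfun.span S"
  shows "F g = G g"
proof -
  have zero: "H 0 = 0" if "linear_functional_on (cfun.span S) H" for H
  proof -
    have "H (cfun_scale 0 0) = 0 * H 0"
      using that cfun.span_zero unfolding linear_functional_on_def by blast
    then show ?thesis
      by simp
  qed
  have "cfun.subspace {g \<in> cfun.span S. F g = G g}"
    using assms(1,2) zero[OF assms(1)] zero[OF assms(2)]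
    by (auto simp: cfun.subspace_def linear_functional_on_def cfun.span_zero cfun.span_add cfun.span_scale)
  then have "cfun.span S \<subseteq> {g \<in> cfun.span S. F g = G g}"
    using assms(3) by (intro cfun.span_minimal) (auto simp: cfun.span_base)
  then show ?thesis
    using assms(4) by blast
qed

theorem lemma1:
  fixes X Y :: "(complex \<Rightarrow> complex) set"
    and NX NY :: "(complex \<Rightarrow> complex) \<Rightarrow> real"
    and n :: nat and lam :: "nat \<Rightarrow> complex" and m :: "nat \<Rightarrow> nat"
    and w :: "nat \<Rightarrow> nat \<Rightarrow> complex"
    and ktilde :: "(complex \<Rightarrow> complex) \<Rightarrow> complex"
  assumes "banach_hol_space X NX"
    and "continuously_embedded X NX"
    and "exact_predual (kernel_span n lam m) Y NY X NX"
    and "n \<ge> 1"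
    and "\<forall>i\<in>{1..n}. lam i \<in> disc"
    and "inj_on lam {1..n}"
    and "\<forall>i\<in>{1..n}. m i \<ge> 1"
    and "kernel_span n lam m \<subseteq> Y"
    and "linear_functional_on (kernel_span n lam m) ktilde"
    and "\<forall>i\<in>{1..n}. \<forall>j<m i. ktilde (disc_kernel (lam i) j) = cnj (w i j)"
  shows "interp_norm X NX n lam m w = functional_norm (kernel_span n lam m) NY ktilde"
proof -
  define S where "S = {disc_kernel (lam i) j |i j. i \<in> {1..n} \<and> j < m i}"
  define K where "K = kernel_span n lam m"
  have K_span: "K = cfun.span S"
    by (simp add: K_def S_def kernel_span_def)
  have kernel_K: "disc_kernel (lam i) j \<in> K" if "i \<in> {1..n}" "j < m i" for i j
    unfolding K_span S_def using that by (intro cfun.span_base) blast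
  have K: "cfun.subspace K" "K \<subseteq> Y" "linear_functional_on K ktilde"
    using assms(8,9) by (auto simp: K_span[symmetric] K_def[symmetric]) (simp add: K_span)
  have Y: "cfun.subspace Y" "norm_on Y NY"
    using assms(3) by (auto simp: exact_predual_def banach_hol_space_def)
  have norm_K: "norm_on K NY"
    using Y(2) K(2) unfolding norm_on_def by (meson subsetD)
  let ?pair = "cauchy_pairing K Y NY"
  have pair_linear: "linear_functional_on Y (\<lambda>g. ?pair g f)" if "f \<in> X" for f
    using assms(3) that by (auto simp: exact_predual_def K_def bounded_functional_on_def)
  have NX_eq: "ereal (NX f) = functional_norm Y NY (\<lambda>g. ?pair g f)" if "f \<in> X" for f
    using assms(3) that by (auto simp: exact_predual_def K_def)
  \<comment> \<open>Kernels lie in \<open>K\<close>, so here the pairing is the series itself and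
    not a limit along polynomials.\<close>
  have pair_kernel: "?pair (disc_kernel (lam i) j) f = cnj ((deriv ^^ j) f (lam i))"
    if "f \<in> X" "i \<in> {1..n}" "j < m i" for f i j
  proof -
    have "f holomorphic_on disc"
      using assms(1) that(1) by (auto simp: banach_hol_space_def hol_disc_def)
    then show ?thesis
      using kernel_K[OF that(2,3)] assms(5) that(2)
      by (simp add: cauchy_pairing_def cauchy_series_disc_kernel)
  qed
  show ?thesis
    unfolding K_def[symmetric]
  proof (rule antisym)
    show "functional_norm K NY ktilde \<le> interp_norm X NX n lam m w"
      unfolding interp_norm_def
    proof (rule INF_greatest)
      fix f assume "f \<in> {f \<in> X. \<forall>i\<in>{1..n}. \<forall>j<m i. (deriv ^^ j) f (lam i) = w i j}"
      then have f: "f \<in> X" and interp: "\<And>i j. i \<in> {1..n} \<Longrightarrow> j < m i \<Longrightarrow> (deriv ^^ j) f (lam i) = w i j"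
        by auto
      have lin: "linear_functional_on K (\<lambda>g. ?pair g f)"
        using pair_linear[OF f] K(2) unfolding linear_functional_on_def by blast
      \<comment> \<open>On each kernel both functionals equal \<open>cnj (w i j)\<close>, and the
        kernels span \<open>K\<close>.\<close>
      have eq: "ktilde g = ?pair g f" if "g \<in> K" for g
      proof (rule linear_functionals_eq_on_span[OF K(3)[unfolded K_span], of "\<lambda>g. ?pair g f"])
        show "ktilde g = ?pair g f" if "g \<in> S" for g
          using that assms(10) interp pair_kernel[OF f] unfolding S_def by auto
      qed (use that lin in \<open>simp_all add: K_span\<close>)
      have "functional_norm K NY ktilde = functional_norm K NY (\<lambda>g. ?pair g f)"
        unfolding functional_norm_def using eq by (intro SUP_cong) auto
      also have "\<dots> \<le> functional_norm Y NY (\<lambda>g. ?pair g f)"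
        unfolding functional_norm_def using K(2) by (intro SUP_subset_mono) auto
      finally show "functional_norm K NY ktilde \<le> ereal (NX f)"
        using NX_eq[OF f] by simp
    qed
  next
    \<comment> \<open>In the extended reals an empty supremum would be \<open>-\<infinity>\<close>;
      the kernel at \<open>lam 1\<close> of order 0 rules this out. A nonnegative finite value
      \<open>r\<close> also makes \<open>r * NY\<close> a seminorm, as the extension theorem
      requires.\<close>
    have "0 \<le> functional_norm K NY ktilde"
    proof -
      have "1 \<in> {1..n}"
        using assms(4) by simp
      moreover from this have "0 < m 1"
        using assms(7) by (metis less_le_trans zero_less_one)
      ultimately have "disc_kernel (lam 1) 0 \<in> K - {0}"
        using kernel_K disc_kernel_0_nonzero by simp
      then have "ereal (cmod (ktilde (disc_kernel (lam 1) 0)) / NY (disc_kernel (lam 1) 0))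
          \<le> functional_norm K NY ktilde"
        unfolding functional_norm_def by (rule SUP_upper)
      moreover have "0 \<le> NY (disc_kernel (lam 1) 0)"
        using norm_K \<open>disc_kernel (lam 1) 0 \<in> K - {0}\<close> by (auto simp: norm_on_def)
      ultimately show ?thesis
        by (smt (verit) divide_nonneg_nonneg ereal_less_eq(5) norm_ge_zero order_trans)
    qed
    then consider "functional_norm K NY ktilde = \<infinity>"
      | r where "0 \<le> r" "functional_norm K NY ktilde = ereal r"
      by (cases "functional_norm K NY ktilde") auto
    then show "interp_norm X NX n lam m w \<le> functional_norm K NY ktilde"
    proof cases
      case 1
      then show ?thesis
        by simp
    next
      case (2 r)
      have k_le: "cmod (ktilde g) \<le> r * NY g" if "g \<in> K" for g
        using functional_norm_le_iff[OF norm_K K(3) cfun.subspace_0[OF K(1)], of r] 2 that by simp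
      obtain F where F_add: "\<And>g h. g \<in> Y \<Longrightarrow> h \<in> Y \<Longrightarrow> F (g + h) = F g + F h"
        and F_scale: "\<And>c g. g \<in> Y \<Longrightarrow> F (cfun_scale c g) = c * F g"
        and F_K: "\<And>g. g \<in> K \<Longrightarrow> F g = ktilde g"
        and F_le: "\<And>g. g \<in> Y \<Longrightarrow> cmod (F g) \<le> r * NY g"
      proof (rule hahn_banach_complex[OF cfun.vector_space_axioms Y(1) K(1,2)])
        show "r * NY (g + h) \<le> r * NY g + r * NY h" if "g \<in> Y" "h \<in> Y" for g h
          using Y(2) that mult_left_mono[OF _ \<open>0 \<le> r\<close>, of "NY (g + h)" "NY g + NY h"]
          by (simp add: norm_on_def distrib_left)
      qed (use K(3) Y(2) k_le in \<open>auto simp: linear_functional_on_def norm_on_def\<close>)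
      have "bounded_functional_on Y NY F"
        using F_add F_scale F_le unfolding bounded_functional_on_def linear_functional_on_def by blast
      \<comment> \<open>Duality: the norm-preserving extension \<open>F\<close> is represented by an
        element of \<open>X\<close>. Testing it on the kernels shows that this element
        interpolates.\<close>
      then obtain f where f: "f \<in> X" "\<And>g. g \<in> Y \<Longrightarrow> F g = ?pair g f"
        using assms(3) unfolding exact_predual_def K_def by metis
      have "(deriv ^^ j) f (lam i) = w i j" if "i \<in> {1..n}" "j < m i" for i j
      proof -
        have "cnj (w i j) = ?pair (disc_kernel (lam i) j) f"
          using assms(10) that kernel_K[OF that] K(2) F_K f(2) by (metis subsetD)
        then show ?thesis
          using pair_kernel[OF f(1) that] by simp
      qed
      \<comment> \<open>\<open>NX f\<close> is exactly the norm of the functional \<open>F\<close>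
        on \<open>Y\<close>, which is at most \<open>r\<close>.\<close>
      then have "interp_norm X NX n lam m w \<le> ereal (NX f)"
        unfolding interp_norm_def using f(1) by (intro INF_lower) auto
      also have "\<dots> \<le> ereal r"
        unfolding NX_eq[OF f(1)]
        using functional_norm_le_iff[OF Y(2) pair_linear[OF f(1)] cfun.subspace_0[OF Y(1)]] F_le f(2)
        by simp
      finally show ?thesis
        using 2 by simp
    qed
  qed
qed

end
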